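(* For every integer $k\ge1$, the free commutative semigroup on $k$ generators, i.e. $((\mathbb N\cup\{0\})^k\setminus\{(0,\dots,0)\},+)$ (in particular $(\mathbb N,+)$), is left and right fairly amenable.
   Context: For a semigroup $U$, $s\in U$, $A\subseteq U$: $s$ acts injectively on the left (right) of $A$ if $a\mapsto sa$ ($a\mapsto as$) is injective on $A$. A finitely-additive probability measure on $U$ is $\mu:\mathcal P(U)\to[0,1]$ with $\mu(U)=1$, additive on disjoint sets; it is left fairly invariant if $\mu(sA)=\mu(A)$ whenever $s$ acts injectively on the left of $A$ (right fairly invariant analogously with $As$). $U$ is left (right) fairly amenable if such a measure exists. *)

theory Defs
  imports Complex_Main
begin

text \<open>A semigroup is given by a carrier set U and an operation m (closed, associative).
  Measures are functions on subsets of U; their values on non-subsets are irrelevant.\<close>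

definition fin_add_prob_measure :: "'a set \<Rightarrow> ('a set \<Rightarrow> real) \<Rightarrow> bool" where
  "fin_add_prob_measure U \<mu> \<longleftrightarrow>
     \<mu> U = 1 \<and> (\<forall>A. A \<subseteq> U \<longrightarrow> 0 \<le> \<mu> A \<and> \<mu> A \<le> 1) \<and>
     (\<forall>A B. A \<subseteq> U \<longrightarrow> B \<subseteq> U \<longrightarrow> A \<inter> B = {} \<longrightarrow> \<mu> (A \<union> B) = \<mu> A + \<mu> B)"

definition left_fairly_invariant :: "'a set \<Rightarrow> ('a \<Rightarrow> 'a \<Rightarrow> 'a) \<Rightarrow> ('a set \<Rightarrow> real) \<Rightarrow> bool" where
  "left_fairly_invariant U m \<mu> \<longleftrightarrow>
     (\<forall>s\<in>U. \<forall>A. A \<subseteq> U \<longrightarrow> inj_on (\<lambda>a. m s a) A \<longrightarrow> \<mu> ((\<lambda>a. m s a) ` A) = \<mu> A)"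

definition right_fairly_invariant :: "'a set \<Rightarrow> ('a \<Rightarrow> 'a \<Rightarrow> 'a) \<Rightarrow> ('a set \<Rightarrow> real) \<Rightarrow> bool" where
  "right_fairly_invariant U m \<mu> \<longleftrightarrow>
     (\<forall>s\<in>U. \<forall>A. A \<subseteq> U \<longrightarrow> inj_on (\<lambda>a. m a s) A \<longrightarrow> \<mu> ((\<lambda>a. m a s) ` A) = \<mu> A)"

definition left_fairly_amenable :: "'a set \<Rightarrow> ('a \<Rightarrow> 'a \<Rightarrow> 'a) \<Rightarrow> bool" where
  "left_fairly_amenable U m \<longleftrightarrow> (\<exists>\<mu>. fin_add_prob_measure U \<mu> \<and> left_fairly_invariant U m \<mu>)"

definition right_fairly_amenable :: "'a set \<Rightarrow> ('a \<Rightarrow> 'a \<Rightarrow> 'a) \<Rightarrow> bool" where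
  "right_fairly_amenable U m \<longleftrightarrow> (\<exists>\<mu>. fin_add_prob_measure U \<mu> \<and> right_fairly_invariant U m \<mu>)"

text \<open>Free commutative semigroup on k generators: nonzero vectors in (N_0)^k,
  represented as functions nat => nat vanishing from index k on, with pointwise addition.\<close>

definition free_comm_sgrp :: "nat \<Rightarrow> (nat \<Rightarrow> nat) set" where
  "free_comm_sgrp k = {x. (\<forall>i\<ge>k. x i = 0) \<and> x \<noteq> (\<lambda>_. 0)}"

definition vec_add :: "(nat \<Rightarrow> nat) \<Rightarrow> (nat \<Rightarrow> nat) \<Rightarrow> (nat \<Rightarrow> nat)" where
  "vec_add x y = (\<lambda>i. x i + y i)"

end

theory Submission
  imports Defs "HOL-Analysis.Analysis"
begin

(*
  Proof idea.  A left and right fairly invariant measure on the free commutative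
  semigroup N_0^k - {0} is obtained as an iterated Banach limit of indicator functions.

  1. Every proper filter lies below an ultrafilter (Zorn); along an ultrafilter every
     sequence with values in a compact set converges.  Fix an ultrafilter finer than
     the cofinite filter on nat.
  2. The ultrafilter limit of the Cesaro averages of a bounded real sequence is a
     Banach limit: it is additive, monotone (bounded by the bounds of the sequence)
     and shift invariant, because shifting changes the n-th average by O(1/n).
  3. Applying this Banach limit successively to the coordinates k-1, ..., 0 of a bounded
     function on vectors gives a functional that is additive, monotone, and invariant
     under translation by vectors supported on the first k coordinates.
  4. The measure of A is this functional applied to the indicator of A.  It is finitely
     additive, the singleton {0} is null, so the semigroup has measure 1, and translation
     invariance gives fair invariance on both sides (translations are injective and the
     semigroup is commutative).
*)

section \<open>Ultrafilters\<close>

definition is_ultrafilter :: "'a filter \<Rightarrow> bool" where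
  "is_ultrafilter F \<longleftrightarrow> F \<noteq> bot \<and> (\<forall>P. eventually P F \<or> eventually (\<lambda>x. \<not> P x) F)"

lemma maximal_filter_is_ultrafilter:
  assumes proper: "U \<noteq> bot"
    and maximal: "\<And>G. G \<noteq> bot \<Longrightarrow> G \<le> U \<Longrightarrow> G = U"
  shows "is_ultrafilter U"
  unfolding is_ultrafilter_def
proof (intro conjI allI proper disjCI)
  fix P
  assume "\<not> eventually (\<lambda>x. \<not> P x) U"
  then have "inf U (principal {x. P x}) \<noteq> bot"
    by (simp add: trivial_limit_def eventually_inf_principal not_eventually)
  then have "inf U (principal {x. P x}) = U"
    by (rule maximal) simp
  moreover have "eventually P (inf U (principal {x. P x}))"
    by (simp add: eventually_inf_principal)
  ultimately show "eventually P U" by simp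
qed

text \<open>Ultrafilter lemma: the proper filters below F, ordered by refinement, have a
  maximal element by Zorn's lemma (a chain is bounded by its infimum).\<close>

lemma ultrafilter_exists:
  fixes F :: "'a filter"
  assumes F: "F \<noteq> bot"
  shows "\<exists>U\<le>F. is_ultrafilter U"
proof -
  let ?R = "{(b, a). a \<noteq> bot \<and> a \<le> b \<and> b \<le> F}"
  have field_R [simp]: "Field ?R = {G. G \<noteq> bot \<and> G \<le> F}"
    by (auto simp: Field_def bot_unique)
  have "\<exists>m\<in>Field ?R. \<forall>a\<in>Field ?R. (m, a) \<in> ?R \<longrightarrow> a = m"
  proof (rule Zorns_po_lemma)
    show "Partial_order ?R"
      by (auto simp: partial_order_on_def preorder_on_def
          antisym_def refl_on_def trans_def Field_def bot_unique)
    show "\<exists>u\<in>Field ?R. \<forall>a\<in>C. (a, u) \<in> ?R" if C: "C \<in> Chains ?R" for C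
    proof (simp, intro exI conjI ballI)
      have Inf_C: "Inf C \<noteq> bot" "Inf C \<le> F" if "C \<noteq> {}"
      proof -
        from C that have "Inf C = bot \<longleftrightarrow> (\<exists>x\<in>C. x = bot)"
          unfolding trivial_limit_def by (intro eventually_Inf_base) (auto simp: Chains_def)
        with C show "Inf C \<noteq> bot"
          by (auto simp: Chains_def)
        from that obtain x where "x \<in> C" by auto
        with C show "Inf C \<le> F"
          by (auto intro!: Inf_lower2[of x] simp: Chains_def)
      qed
      then have [simp]: "inf F (Inf C) = (if C = {} then F else Inf C)"
        using C by (auto simp add: inf_absorb2)
      from C show "inf F (Inf C) \<noteq> bot" "inf F (Inf C) \<le> F"
        by (simp_all add: F Inf_C)
      with C show "inf F (Inf C) \<le> x" "x \<le> F" if "x \<in> C" for x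
        using that by (auto intro: Inf_lower simp: Chains_def)
    qed
  qed
  then obtain U where U: "U \<noteq> bot" "U \<le> F"
    and max: "\<And>G. G \<in> Field ?R \<Longrightarrow> (U, G) \<in> ?R \<Longrightarrow> G = U"
    by auto
  have "is_ultrafilter U"
  proof (rule maximal_filter_is_ultrafilter[OF U(1)])
    fix G assume "G \<noteq> bot" "G \<le> U"
    with U(2) show "G = U"
      by (intro max) auto
  qed
  with U(2) show ?thesis by blast
qed

text \<open>Along an ultrafilter, a function eventually taking values in a compact set
  converges: the ultrafilter decides every neighbourhood of a cluster point.\<close>

lemma ultrafilter_compact_tendsto:
  fixes h :: "'a \<Rightarrow> 'b::topological_space"
  assumes U: "is_ultrafilter U" and K: "compact K" and ev: "eventually (\<lambda>x. h x \<in> K) U"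
  shows "\<exists>l. (h \<longlongrightarrow> l) U"
proof -
  have "filtermap h U \<noteq> bot"
    using U by (simp add: is_ultrafilter_def filtermap_bot_iff)
  then obtain l where cluster: "inf (nhds l) (filtermap h U) \<noteq> bot"
    using K ev unfolding compact_filter by (auto simp: eventually_filtermap)
  have "(h \<longlongrightarrow> l) U"
  proof (rule topological_tendstoI)
    fix S assume S: "open S" "l \<in> S"
    show "eventually (\<lambda>x. h x \<in> S) U"
    proof (rule ccontr)
      assume "\<not> eventually (\<lambda>x. h x \<in> S) U"
      with U have "eventually (\<lambda>y. y \<notin> S) (filtermap h U)"
        by (auto simp: is_ultrafilter_def eventually_filtermap)
      moreover have "eventually (\<lambda>y. y \<in> S) (nhds l)"
        using S by (rule eventually_nhds_in_open)
      ultimately have "eventually (\<lambda>_. False) (inf (nhds l) (filtermap h U))"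
        unfolding eventually_inf by blast
      with cluster show False
        by (simp add: trivial_limit_def)
    qed
  qed
  then show ?thesis ..
qed

definition free_ultrafilter :: "nat filter" where
  "free_ultrafilter = (SOME U. U \<le> sequentially \<and> is_ultrafilter U)"

lemma free_ultrafilter: "free_ultrafilter \<le> sequentially" "is_ultrafilter free_ultrafilter"
proof -
  have "\<exists>U. U \<le> sequentially \<and> is_ultrafilter U"
    using ultrafilter_exists[of "sequentially :: nat filter"] by auto
  then have "free_ultrafilter \<le> sequentially \<and> is_ultrafilter free_ultrafilter"
    unfolding free_ultrafilter_def by (rule someI_ex)
  then show "free_ultrafilter \<le> sequentially" "is_ultrafilter free_ultrafilter" by auto
qed

lemma free_ultrafilter_proper: "free_ultrafilter \<noteq> bot"
  using free_ultrafilter(2) by (simp add: is_ultrafilter_def)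

section \<open>A Banach limit on bounded real sequences\<close>

definition cesaro_avg :: "(nat \<Rightarrow> real) \<Rightarrow> nat \<Rightarrow> real" where
  "cesaro_avg g n = (\<Sum>j<n. g j) / real n"

definition banach_lim :: "(nat \<Rightarrow> real) \<Rightarrow> real" where
  "banach_lim g = Lim free_ultrafilter (cesaro_avg g)"

lemma cesaro_avg_bounds:
  assumes "\<And>j. c \<le> g j" "\<And>j. g j \<le> d" "n \<ge> 1"
  shows "c \<le> cesaro_avg g n \<and> cesaro_avg g n \<le> d"
proof -
  have "real n * c \<le> (\<Sum>j<n. g j)"
    using sum_mono[of "{..<n}" "\<lambda>_. c" g] assms(1) by simp
  moreover have "(\<Sum>j<n. g j) \<le> real n * d"
    using sum_mono[of "{..<n}" g "\<lambda>_. d"] assms(2) by simp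
  ultimately show ?thesis
    using assms(3) by (simp add: cesaro_avg_def field_simps)
qed

lemma cesaro_avg_abs_bound:
  assumes "\<And>j. \<bar>g j\<bar> \<le> B"
  shows "\<bar>cesaro_avg g n\<bar> \<le> max B 0"
proof (cases "n = 0")
  case False
  have "-B \<le> g j" "g j \<le> B" for j
    using assms[of j] by auto
  then have "-B \<le> cesaro_avg g n \<and> cesaro_avg g n \<le> B"
    using False by (intro cesaro_avg_bounds) auto
  then show ?thesis by auto
qed (simp add: cesaro_avg_def)

lemma banach_lim_tendsto:
  assumes "\<And>j. \<bar>g j\<bar> \<le> B"
  shows "(cesaro_avg g \<longlongrightarrow> banach_lim g) free_ultrafilter"
proof -
  have "cesaro_avg g n \<in> {-max B 0..max B 0}" for n
    using cesaro_avg_abs_bound[of g B n, OF assms] by (auto simp: abs_le_iff)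
  then have "eventually (\<lambda>n. cesaro_avg g n \<in> {-max B 0..max B 0}) free_ultrafilter"
    by simp
  then obtain l where "(cesaro_avg g \<longlongrightarrow> l) free_ultrafilter"
    using ultrafilter_compact_tendsto[OF free_ultrafilter(2) compact_Icc] by blast
  then show ?thesis
    unfolding banach_lim_def using free_ultrafilter_proper by (metis tendsto_Lim)
qed

lemma banach_lim_unique:
  assumes "\<And>j. \<bar>g j\<bar> \<le> B" "(cesaro_avg g \<longlongrightarrow> l) free_ultrafilter"
  shows "banach_lim g = l"
  using tendsto_unique[OF free_ultrafilter_proper banach_lim_tendsto[of g B, OF assms(1)] assms(2)] .

lemma banach_lim_add:
  assumes "\<And>j. \<bar>g j\<bar> \<le> B" "\<And>j. \<bar>h j\<bar> \<le> C"
  shows "banach_lim (\<lambda>j. g j + h j) = banach_lim g + banach_lim h"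
proof (rule banach_lim_unique)
  show "\<bar>g j + h j\<bar> \<le> B + C" for j
    using assms[of j] by auto
  have "cesaro_avg (\<lambda>j. g j + h j) = (\<lambda>n. cesaro_avg g n + cesaro_avg h n)"
    by (auto simp: cesaro_avg_def sum.distrib add_divide_distrib)
  then show "(cesaro_avg (\<lambda>j. g j + h j) \<longlongrightarrow> banach_lim g + banach_lim h) free_ultrafilter"
    using tendsto_add[OF banach_lim_tendsto[of g B, OF assms(1)] banach_lim_tendsto[of h C, OF assms(2)]] by simp
qed

text \<open>Monotonicity: bounds on the sequence are bounds on its Banach limit (the ultrafilter
  is free, so eventually n \<ge> 1 and the averages obey the bounds).\<close>

lemma banach_lim_bounds:
  assumes "\<And>j. c \<le> g j" "\<And>j. g j \<le> d"
  shows "c \<le> banach_lim g \<and> banach_lim g \<le> d"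
proof -
  have "\<bar>g j\<bar> \<le> \<bar>c\<bar> + \<bar>d\<bar>" for j
    using assms[of j] by auto
  then have lim: "(cesaro_avg g \<longlongrightarrow> banach_lim g) free_ultrafilter"
    by (rule banach_lim_tendsto)
  have "eventually (\<lambda>n::nat. n \<ge> 1) free_ultrafilter"
    using free_ultrafilter(1) eventually_ge_at_top[of "1::nat"] by (auto simp: le_filter_def)
  then have "eventually (\<lambda>n. c \<le> cesaro_avg g n) free_ultrafilter"
    and "eventually (\<lambda>n. cesaro_avg g n \<le> d) free_ultrafilter"
    using cesaro_avg_bounds[of c g d] assms by (auto elim: eventually_mono)
  then show ?thesis
    using tendsto_le[OF free_ultrafilter_proper lim tendsto_const]
      tendsto_le[OF free_ultrafilter_proper tendsto_const lim] by blast
qed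

lemma banach_lim_const: "banach_lim (\<lambda>_. c) = c"
  using banach_lim_bounds[of c "\<lambda>_. c" c] by auto

lemma partial_sum_shift_bound:
  fixes g :: "nat \<Rightarrow> real"
  assumes "\<And>j. \<bar>g j\<bar> \<le> B"
  shows "\<bar>(\<Sum>j<n. g (j + s)) - (\<Sum>j<n. g j)\<bar> \<le> 2 * s * B"
proof -
  have split: "(\<Sum>j<a + b. g j) = (\<Sum>j<a. g j) + (\<Sum>j<b. g (a + j))" for a b
    by (induction b) (auto simp: add.assoc)
  have "(\<Sum>j<n. g (j + s)) - (\<Sum>j<n. g j) = (\<Sum>j<s. g (n + j)) - (\<Sum>j<s. g j)"
    using split[of s n] split[of n s] by (simp add: add.commute)
  moreover have block: "\<bar>\<Sum>j<s. g (a + j)\<bar> \<le> s * B" for a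
  proof -
    have "\<bar>\<Sum>j<s. g (a + j)\<bar> \<le> (\<Sum>j<s. \<bar>g (a + j)\<bar>)" by (rule sum_abs)
    also have "\<dots> \<le> (\<Sum>j<s. B)" by (rule sum_mono) (use assms in auto)
    finally show ?thesis by simp
  qed
  ultimately show ?thesis
    using block[of n] block[of 0] abs_triangle_ineq4[of "\<Sum>j<s. g (n + j)" "\<Sum>j<s. g j"]
    by (simp, linarith)
qed

text \<open>Shift invariance: the difference of the averages is O(1/n), hence tends to 0
  along the cofinite filter and a fortiori along the free ultrafilter.\<close>

lemma banach_lim_shift:
  assumes bound: "\<And>j. \<bar>g j\<bar> \<le> B"
  shows "banach_lim (\<lambda>j. g (j + s)) = banach_lim g"
proof (rule banach_lim_unique)
  show "\<bar>g (j + s)\<bar> \<le> B" for j by (rule bound)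
  have diff: "\<bar>cesaro_avg (\<lambda>j. g (j + s)) n - cesaro_avg g n\<bar> \<le> 2 * s * B / real n" for n
    using partial_sum_shift_bound[where g = g and B = B and n = n and s = s] bound
    by (simp add: cesaro_avg_def flip: diff_divide_distrib) (simp add: divide_right_mono)
  have "((\<lambda>n. 2 * s * B / real n) \<longlongrightarrow> 0) sequentially"
    by (intro tendsto_divide_0[OF tendsto_const]
        filterlim_at_top_imp_at_infinity[OF filterlim_real_sequentially])
  then have "((\<lambda>n. cesaro_avg (\<lambda>j. g (j + s)) n - cesaro_avg g n) \<longlongrightarrow> 0) sequentially"
    by (rule Lim_null_comparison[rotated]) (use diff in auto)
  then have "((\<lambda>n. cesaro_avg (\<lambda>j. g (j + s)) n - cesaro_avg g n) \<longlongrightarrow> 0) free_ultrafilter"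
    using free_ultrafilter(1) by (rule tendsto_mono[rotated])
  from tendsto_add[OF this banach_lim_tendsto[of g B, OF bound]]
  show "(cesaro_avg (\<lambda>j. g (j + s)) \<longlongrightarrow> banach_lim g) free_ultrafilter"
    by simp
qed

lemma banach_lim_tail_cong:
  assumes "\<And>j. \<bar>g j\<bar> \<le> B" "\<And>j. \<bar>h j\<bar> \<le> C" "\<And>j. j \<ge> s \<Longrightarrow> g j = h j"
  shows "banach_lim g = banach_lim h"
proof -
  have "banach_lim g = banach_lim (\<lambda>j. g (j + s))"
    using banach_lim_shift[of g B s] assms(1) by simp
  also have "\<dots> = banach_lim (\<lambda>j. h (j + s))"
    using assms(3) by simp
  also have "\<dots> = banach_lim h"
    using banach_lim_shift[of h C s] assms(2) by simp
  finally show ?thesis .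
qed

section \<open>Iterated Banach limits of functions on vectors\<close>

text \<open>iter_lim j f x takes Banach limits of f successively in the coordinates j-1, ..., 0,
  starting at the point x; the result no longer depends on these coordinates of x.\<close>

fun iter_lim :: "nat \<Rightarrow> ((nat \<Rightarrow> nat) \<Rightarrow> real) \<Rightarrow> (nat \<Rightarrow> nat) \<Rightarrow> real" where
  "iter_lim 0 f x = f x"
| "iter_lim (Suc j) f x = banach_lim (\<lambda>n. iter_lim j f (x(j := n)))"

lemma iter_lim_bounds:
  assumes "\<And>y. c \<le> f y \<and> f y \<le> d"
  shows "c \<le> iter_lim j f x \<and> iter_lim j f x \<le> d"
proof (induction j arbitrary: x)
  case 0
  then show ?case using assms by simp
next
  case (Suc j)
  then show ?case
    by simp (rule banach_lim_bounds; use Suc.IH in blast)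
qed

lemma iter_lim_abs_bound:
  assumes "\<And>y. \<bar>f y\<bar> \<le> B"
  shows "\<bar>iter_lim j f x\<bar> \<le> B"
proof -
  have "-B \<le> f y \<and> f y \<le> B" for y
    using assms[of y] by auto
  then have "-B \<le> iter_lim j f x \<and> iter_lim j f x \<le> B"
    by (rule iter_lim_bounds)
  then show ?thesis by auto
qed

lemma iter_lim_const: "iter_lim j (\<lambda>_. c) x = c"
  using iter_lim_bounds[of c "\<lambda>_. c" c j x] by simp

lemma iter_lim_add:
  assumes "\<And>y. \<bar>f y\<bar> \<le> B" "\<And>y. \<bar>g y\<bar> \<le> C"
  shows "iter_lim j (\<lambda>y. f y + g y) x = iter_lim j f x + iter_lim j g x"
proof (induction j arbitrary: x)
  case (Suc j)
  have "iter_lim (Suc j) (\<lambda>y. f y + g y) x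
      = banach_lim (\<lambda>n. iter_lim j f (x(j := n)) + iter_lim j g (x(j := n)))"
    by (simp only: iter_lim.simps Suc.IH)
  also have "\<dots> = iter_lim (Suc j) f x + iter_lim (Suc j) g x"
    by simp (rule banach_lim_add; use iter_lim_abs_bound assms in blast)
  finally show ?case .
qed simp

lemma iter_lim_cong:
  assumes "\<forall>i\<ge>j. x i = x' i"
    and "\<And>y. \<forall>i\<ge>j. y i = x i \<Longrightarrow> f y = g y"
  shows "iter_lim j f x = iter_lim j g x'"
  using assms
proof (induction j arbitrary: x x')
  case 0
  then have "x = x'" by auto
  with "0.prems"(2)[of x] show ?case by simp
next
  case (Suc j)
  have "iter_lim j f (x(j := n)) = iter_lim j g (x'(j := n))" for n
    by (rule Suc.IH) (use Suc.prems in auto)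
  then show ?case by simp
qed

lemma iter_lim_vanishing:
  assumes "\<And>y. \<bar>f y\<bar> \<le> B" and vanish: "\<And>y. y j \<ge> t \<Longrightarrow> f y = 0"
  shows "iter_lim (Suc j) f x = 0"
proof -
  have "iter_lim j f (x(j := n)) = iter_lim j (\<lambda>_. 0) (x(j := n))" if "n \<ge> t" for n
    by (rule iter_lim_cong) (use vanish that in auto)
  then have "banach_lim (\<lambda>n. iter_lim j f (x(j := n))) = banach_lim (\<lambda>_. 0)"
    using iter_lim_abs_bound[of f B] assms(1)
    by (intro banach_lim_tail_cong[where B = B and C = 0 and s = t]) (auto simp: iter_lim_const)
  then show ?thesis
    by (simp add: banach_lim_const)
qed

text \<open>Translation invariance, inherited coordinatewise from shift invariance.\<close>

lemma iter_lim_translate: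
  assumes bound: "\<And>y. \<bar>f y\<bar> \<le> B"
  shows "iter_lim j (\<lambda>y. f (vec_add y s)) x = iter_lim j f (vec_add x s)"
proof (induction j arbitrary: x)
  case (Suc j)
  have upd: "vec_add (x(j := n)) s = (vec_add x s)(j := n + s j)" for n
    by (auto simp: vec_add_def)
  have "iter_lim (Suc j) (\<lambda>y. f (vec_add y s)) x
      = banach_lim (\<lambda>n. iter_lim j f ((vec_add x s)(j := n + s j)))"
    by (simp only: iter_lim.simps Suc.IH upd)
  also have "\<dots> = iter_lim (Suc j) f (vec_add x s)"
    using banach_lim_shift[of "\<lambda>n. iter_lim j f ((vec_add x s)(j := n))" B "s j"]
      iter_lim_abs_bound[of f B] bound
    by simp
  finally show ?case .
qed simp

section \<open>The fairly invariant measure\<close>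

definition fair_measure :: "nat \<Rightarrow> (nat \<Rightarrow> nat) set \<Rightarrow> real" where
  "fair_measure k A = iter_lim k (indicator A) (\<lambda>_. 0)"

lemma indicator_abs_bound: "\<bar>indicator A y :: real\<bar> \<le> 1"
  by (simp add: indicator_def)

lemma fair_measure_bounds: "0 \<le> fair_measure k A \<and> fair_measure k A \<le> 1"
  unfolding fair_measure_def by (rule iter_lim_bounds) (simp add: indicator_def)

lemma fair_measure_disjoint_union:
  assumes "A \<inter> B = {}"
  shows "fair_measure k (A \<union> B) = fair_measure k A + fair_measure k B"
proof -
  have "indicator (A \<union> B) = (\<lambda>y. indicator A y + indicator B y :: real)"
    using assms by (auto simp: fun_eq_iff indicator_disj_union)
  then show ?thesis
    unfolding fair_measure_def
    using iter_lim_add[of "indicator A" 1 "indicator B" 1] indicator_abs_bound by simp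
qed

lemma fair_measure_support: "fair_measure k {y. \<forall>i\<ge>k. y i = 0} = 1"
  unfolding fair_measure_def
  by (subst iter_lim_cong[where g = "\<lambda>_. 1" and x' = "\<lambda>_. 0"]) (auto simp: iter_lim_const)

text \<open>Points are null: the indicator of 0 vanishes once coordinate k-1 is nonzero.\<close>

lemma fair_measure_zero_vector:
  assumes "k \<ge> 1"
  shows "fair_measure k {\<lambda>_. 0} = 0"
proof -
  obtain j where k: "k = Suc j"
    using assms by (cases k) auto
  show ?thesis
    unfolding fair_measure_def k
    by (rule iter_lim_vanishing[where B = 1 and t = 1]) (auto simp: indicator_def)
qed

lemma fair_measure_semigroup:
  assumes "k \<ge> 1"
  shows "fair_measure k (free_comm_sgrp k) = 1"
proof -
  have "{y. \<forall>i\<ge>k. y i = 0} = free_comm_sgrp k \<union> {\<lambda>_. 0}"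
    "free_comm_sgrp k \<inter> {\<lambda>_. 0} = {}"
    by (auto simp: free_comm_sgrp_def)
  then show ?thesis
    using fair_measure_support[of k] fair_measure_zero_vector[OF assms]
      fair_measure_disjoint_union[of "free_comm_sgrp k" "{\<lambda>_. 0}" k]
    by simp
qed

lemma fair_measure_prob:
  assumes "k \<ge> 1"
  shows "fin_add_prob_measure (free_comm_sgrp k) (fair_measure k)"
  unfolding fin_add_prob_measure_def
  using fair_measure_semigroup[OF assms] fair_measure_bounds fair_measure_disjoint_union
  by blast

lemma vec_add_commute: "vec_add a b = vec_add b a"
  by (auto simp: vec_add_def fun_eq_iff)

lemma vec_add_cancel: "vec_add y s = vec_add a s \<longleftrightarrow> y = a"
  by (auto simp: vec_add_def fun_eq_iff)

text \<open>Invariance under translation by any vector supported on the first k coordinates;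
  since translations are injective, no injectivity hypothesis is needed.\<close>

lemma fair_measure_translate:
  assumes s: "\<forall>i\<ge>k. s i = 0"
  shows "fair_measure k ((\<lambda>a. vec_add a s) ` A) = fair_measure k A"
proof -
  let ?T = "(\<lambda>a. vec_add a s) ` A"
  have "indicator ?T (vec_add y s) = (indicator A y :: real)" for y
    by (auto simp: indicator_def vec_add_cancel)
  then have "fair_measure k A = iter_lim k (\<lambda>y. indicator ?T (vec_add y s)) (\<lambda>_. 0)"
    unfolding fair_measure_def by simp
  also have "\<dots> = iter_lim k (indicator ?T) (vec_add (\<lambda>_. 0) s)"
    by (rule iter_lim_translate[OF indicator_abs_bound])
  also have "\<dots> = fair_measure k ?T"
    unfolding fair_measure_def by (rule iter_lim_cong) (use s in \<open>auto simp: vec_add_def\<close>)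
  finally show ?thesis by simp
qed

theorem mainTheorem17:
  fixes k :: nat
  assumes "k \<ge> 1"
  shows "left_fairly_amenable (free_comm_sgrp k) vec_add \<and> right_fairly_amenable (free_comm_sgrp k) vec_add"
proof -
  let ?U = "free_comm_sgrp k"
  have supp: "\<forall>i\<ge>k. s i = 0" if "s \<in> ?U" for s
    using that by (simp add: free_comm_sgrp_def)
  have "right_fairly_invariant ?U vec_add (fair_measure k)"
    unfolding right_fairly_invariant_def using supp fair_measure_translate by blast
  moreover have "left_fairly_invariant ?U vec_add (fair_measure k)"
    unfolding left_fairly_invariant_def using supp fair_measure_translate
    by (simp add: vec_add_commute[of _ "_ :: nat \<Rightarrow> nat"])
  ultimately show ?thesis
    unfolding left_fairly_amenable_def right_fairly_amenable_def
    using fair_measure_prob[OF assms] by blast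
qed

end
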